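(* Let $G$ be a finite simple connected graph of girth $g$ and cycle rank $\beta=|E(G)|-|V(G)|+1$. Fix any total ordering of $E(G)$, and let $h_G(z)=\sum_j h_j z^j$ be the $h$-polynomial of the broken-circuit complex $\mathrm{BC}(G)$. Then $$h_j=\binom{\beta+j-1}{j}\qquad(0\le j\le g-2).$$ If $c_g(G)$ denotes the number of simple cycles of length $g$ in $G$, then $$h_{g-1}=\binom{\beta+g-2}{g-1}-c_g(G).$$
   Context: The girth $g$ is the length of a shortest cycle of $G$ (so $G$ contains a cycle). Simple cycles are counted as subgraphs. For a finite connected loopless graph $G$ with a fixed total order on $E(G)$, a broken circuit is a set $C\setminus\{\max C\}$, where $C$ is the edge set of a cycle of $G$ and $\max C$ is its largest edge. The broken-circuit complex $\mathrm{BC}(G)$ is the simplicial complex on $E(G)$ whose faces are the edge sets containing no broken circuit. With $r=|V(G)|-1$ and $b_i$ the number of faces of $\mathrm{BC}(G)$ having exactly $i$ elements, the $h$-polynomial of $\mathrm{BC}(G)$ is $h_G(z)=\sum_{i=0}^{r}b_i z^i(1-z)^{r-i}$. *)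

theory Defs
  imports "HOL-Computational_Algebra.Polynomial"
begin

text \<open>
  A simple graph is given by its vertex set and its set of edges, an edge being the two-element set
  of its endpoints; so there are neither loops nor parallel edges.
\<close>

definition finite_simple_graph :: "'a set \<Rightarrow> 'a set set \<Rightarrow> bool" where
  "finite_simple_graph V E \<longleftrightarrow> finite V \<and> (\<forall>e\<in>E. e \<subseteq> V \<and> card e = 2)"

definition connected_graph :: "'a set \<Rightarrow> 'a set set \<Rightarrow> bool" where
  "connected_graph V E \<longleftrightarrow> V \<noteq> {} \<and> (\<forall>u\<in>V. \<forall>v\<in>V. (u, v) \<in> {(x, y). {x, y} \<in> E}\<^sup>*)"

text \<open>The edges of the closed polygon through the vertices \<open>xs\<close> in cyclic order.\<close>

definition polygon_edges :: "'a list \<Rightarrow> 'a set set" where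
  "polygon_edges xs = {{xs ! i, xs ! (Suc i mod length xs)} | i. i < length xs}"

text \<open>
  A cycle, as a subgraph, is determined by its edge set, and its length is the
  number of its edges. So cycles are represented by their edge sets, and counting these sets counts
  cycles as subgraphs, irrespective of starting vertex and direction.
\<close>

definition is_cycle :: "'a set set \<Rightarrow> 'a set set \<Rightarrow> bool" where
  "is_cycle E C \<longleftrightarrow> (\<exists>xs. 3 \<le> length xs \<and> distinct xs \<and> C = polygon_edges xs \<and> C \<subseteq> E)"

text \<open>Meaningful only for graphs that contain a cycle.\<close>

definition girth :: "'a set set \<Rightarrow> nat" where
  "girth E = (LEAST n. \<exists>C. is_cycle E C \<and> card C = n)"

definition num_cycles :: "'a set set \<Rightarrow> nat \<Rightarrow> nat" where
  "num_cycles E n = card {C. is_cycle E C \<and> card C = n}"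

text \<open>
  The subtraction on \<open>nat\<close> is not truncated for a finite connected graph, which has at least
  \<open>card V - 1\<close> edges.
\<close>

definition cycle_rank :: "'a set \<Rightarrow> 'a set set \<Rightarrow> nat" where
  "cycle_rank V E = card E + 1 - card V"

text \<open>
  The total order on the edges is a reflexive relation \<open>R\<close>, where \<open>(e, f) \<in> R\<close> means that
  \<open>e\<close> is at most \<open>f\<close>; a broken circuit is a cycle with its largest edge removed.
\<close>

definition broken_circuit :: "'a set set \<Rightarrow> 'a set rel \<Rightarrow> 'a set set \<Rightarrow> bool" where
  "broken_circuit E R B \<longleftrightarrow>
     (\<exists>C m. is_cycle E C \<and> m \<in> C \<and> (\<forall>e\<in>C. (e, m) \<in> R) \<and> B = C - {m})"

definition BC :: "'a set set \<Rightarrow> 'a set rel \<Rightarrow> 'a set set set" where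
  "BC E R = {S. S \<subseteq> E \<and> \<not> (\<exists>B. broken_circuit E R B \<and> B \<subseteq> S)}"

definition num_faces :: "'a set set set \<Rightarrow> nat \<Rightarrow> nat" where
  "num_faces \<Delta> i = card {S \<in> \<Delta>. card S = i}"

text \<open>The polynomials \<open>[:0, 1:]\<close> and \<open>[:1, -1:]\<close> are \<open>z\<close> and \<open>1 - z\<close>.\<close>

definition h_poly :: "'a set \<Rightarrow> 'a set set \<Rightarrow> 'a set rel \<Rightarrow> int poly" where
  "h_poly V E R =
     (let r = card V - 1
      in \<Sum>i=0..r. of_nat (num_faces (BC E R) i) * [:0, 1:] ^ i * [:1, -1:] ^ (r - i))"

end

theory Submission
  imports Defs "HOL-Computational_Algebra.Formal_Power_Series"
begin

text \<open>
  Every broken circuit has at least \<open>g - 1\<close> edges, so \<open>b\<^sub>i\<close> is the binomial coefficient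
  \<open>|E|\<close> over \<open>i\<close> for \<open>i \<le> g - 2\<close>, while for \<open>i = g - 1\<close> exactly the broken circuits of
  \<open>g\<close>-cycles are missing. Distinct \<open>g\<close>-cycles have distinct broken circuits, because the removed
  edge is recovered as the set of vertices of odd degree. Expanding \<open>(1 - z)\<^sup>r\<^sup>-\<^sup>i\<close> and applying
  Vandermonde's identity with the negative upper index \<open>j - r - 1\<close> gives the \<open>h\<^sub>j\<close>.
\<close>

subsection \<open>Cycles\<close>

lemma polygon_edges_image:
  "polygon_edges xs = (\<lambda>i. {xs ! i, xs ! (Suc i mod length xs)}) ` {..<length xs}"
  by (auto simp: polygon_edges_def)

text \<open>Two indices give the same edge only if they are equal or each is the cyclic successor of
  the other; the latter would force the length to divide 2.\<close>

lemma inj_on_polygon_edge: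
  assumes "distinct xs" "3 \<le> length xs"
  shows "inj_on (\<lambda>i. {xs ! i, xs ! (Suc i mod length xs)}) {..<length xs}"
proof (rule inj_onI)
  fix i j
  assume ij: "i \<in> {..<length xs}" "j \<in> {..<length xs}"
    and eq: "{xs ! i, xs ! (Suc i mod length xs)} = {xs ! j, xs ! (Suc j mod length xs)}"
  have nz: "xs \<noteq> []" using assms by auto
  have "i = j \<or> (i = Suc j mod length xs \<and> Suc i mod length xs = j)"
    using eq ij nz assms(1)
    by (auto simp: doubleton_eq_iff nth_eq_iff_index_eq)
  then show "i = j"
    using ij assms(2) by (auto simp: mod_Suc split: if_splits)
qed

lemma card_polygon_edges:
  "distinct xs \<Longrightarrow> 3 \<le> length xs \<Longrightarrow> card (polygon_edges xs) = length xs"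
  by (simp add: polygon_edges_image card_image inj_on_polygon_edge)

text \<open>An edge at \<open>v\<close> has an index \<open>i\<close> with \<open>xs ! i = v\<close>
  or \<open>xs ! (Suc i mod ?n) = v\<close>. The two index sets are disjoint and equinumerous, so
  the degree is twice the size of either.\<close>

lemma even_degree_polygon_edges:
  assumes "distinct xs" "3 \<le> length xs"
  shows "even (card {e \<in> polygon_edges xs. v \<in> e})"
proof -
  let ?n = "length xs"
  let ?f = "\<lambda>i. {xs ! i, xs ! (Suc i mod ?n)}"
  let ?A = "{i. i < ?n \<and> xs ! i = v}"
  let ?B = "{i. i < ?n \<and> xs ! (Suc i mod ?n) = v}"
  have "{e \<in> polygon_edges xs. v \<in> e} = ?f ` (?A \<union> ?B)"
    by (auto simp: polygon_edges_image)
  moreover have "inj_on ?f (?A \<union> ?B)"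
    by (rule inj_on_subset[OF inj_on_polygon_edge[OF assms]]) auto
  ultimately have "card {e \<in> polygon_edges xs. v \<in> e} = card (?A \<union> ?B)"
    by (simp add: card_image)
  also have "\<dots> = card ?A + card ?B"
  proof (rule card_Un_disjoint)
    show "?A \<inter> ?B = {}"
    proof (rule ccontr)
      assume "?A \<inter> ?B \<noteq> {}"
      then obtain i where i: "i < ?n" "xs ! i = xs ! (Suc i mod ?n)" by (auto, metis)
      moreover have "Suc i mod ?n < ?n" using assms(2) by (intro mod_less_divisor) linarith
      ultimately have "i = Suc i mod ?n"
        using assms(1) nth_eq_iff_index_eq by blast
      then show False using i assms(2) by (auto simp: mod_Suc split: if_splits)
    qed
  qed auto
  \<comment> \<open>The cyclic shift permutes the indices and carries \<open>?B\<close> onto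
    \<open>?A\<close>.\<close>
  also have "card ?A = card ?B"
  proof -
    have inj: "inj_on (\<lambda>i. Suc i mod ?n) {..<?n}"
      by (rule inj_onI) (auto simp: mod_Suc split: if_splits)
    have surj: "(\<lambda>i. Suc i mod ?n) ` {..<?n} = {..<?n}"
      by (rule card_subset_eq) (simp_all only: card_image[OF inj], auto simp: mod_Suc)
    have "?A = {i \<in> (\<lambda>i. Suc i mod ?n) ` {..<?n}. xs ! i = v}"
      unfolding surj by auto
    also have "\<dots> = (\<lambda>i. Suc i mod ?n) ` ?B" by blast
    finally have "?A = (\<lambda>i. Suc i mod ?n) ` ?B" .
    moreover have "inj_on (\<lambda>i. Suc i mod ?n) ?B"
      by (rule inj_on_subset[OF inj]) auto
    ultimately show ?thesis by (simp add: card_image)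
  qed
  finally show ?thesis by simp
qed

lemma is_cycle_even_degree: "is_cycle E C \<Longrightarrow> even (card {e \<in> C. v \<in> e})"
  by (auto simp: is_cycle_def even_degree_polygon_edges)

lemma is_cycle_subset: "is_cycle E C \<Longrightarrow> C \<subseteq> E"
  by (auto simp: is_cycle_def)

lemma is_cycle_card_ge_3: "is_cycle E C \<Longrightarrow> 3 \<le> card C"
  by (auto simp: is_cycle_def card_polygon_edges)

lemma is_cycle_finite: "is_cycle E C \<Longrightarrow> finite C"
  using is_cycle_card_ge_3 by (metis card.infinite not_numeral_le_zero)

text \<open>Bounds the girth by \<open>card V\<close>, so that \<open>girth E - 1\<close> stays in
  the range of exponents for which \<open>coeff_h_poly\<close> holds.\<close>

lemma is_cycle_card_le:
  assumes "finite V" "\<And>e. e \<in> E \<Longrightarrow> e \<subseteq> V" "is_cycle E C"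
  shows "card C \<le> card V"
proof -
  obtain xs where xs: "3 \<le> length xs" "distinct xs" "C = polygon_edges xs" "C \<subseteq> E"
    using assms(3) by (auto simp: is_cycle_def)
  have "xs ! i \<in> V" if "i < length xs" for i
  proof -
    have "{xs ! i, xs ! (Suc i mod length xs)} \<in> E"
      using xs(3,4) that unfolding polygon_edges_image by blast
    then show ?thesis using assms(2) by blast
  qed
  then have "set xs \<subseteq> V" by (auto simp: set_conv_nth)
  then show ?thesis
    using xs assms(1) card_mono[of V "set xs"] by (simp add: card_polygon_edges distinct_card)
qed

text \<open>All degrees in \<open>C\<close> are even, so deleting \<open>m\<close> makes them odd
  exactly at the endpoints of \<open>m\<close>. Hence \<open>C - {m}\<close> alone determines
  \<open>m\<close>.\<close>

lemma is_cycle_removed_edge: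
  assumes "is_cycle E C" "m \<in> C"
  shows "m = {v. odd (card {e \<in> C - {m}. v \<in> e})}"
proof -
  have fin: "finite C" using assms(1) by (rule is_cycle_finite)
  have "v \<in> m \<longleftrightarrow> odd (card {e \<in> C - {m}. v \<in> e})" for v
  proof (cases "v \<in> m")
    case True
    then have "{e \<in> C. v \<in> e} = insert m {e \<in> C - {m}. v \<in> e}" using assms(2) by auto
    then have "card {e \<in> C. v \<in> e} = Suc (card {e \<in> C - {m}. v \<in> e})"
      using fin by simp
    then show ?thesis using is_cycle_even_degree[OF assms(1), of v] True by simp
  next
    case False
    then have "{e \<in> C. v \<in> e} = {e \<in> C - {m}. v \<in> e}" by auto
    then show ?thesis using is_cycle_even_degree[OF assms(1), of v] False by simp
  qed
  then show ?thesis by blast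
qed

lemma is_cycle_Diff_inject:
  assumes "is_cycle E C" "is_cycle E C'" "m \<in> C" "m' \<in> C'" "C - {m} = C' - {m'}"
  shows "C = C'"
  using is_cycle_removed_edge[OF assms(1,3)] is_cycle_removed_edge[OF assms(2,4)] assms(3-5)
  by (metis insert_Diff)

lemma girth_le: "is_cycle E C \<Longrightarrow> girth E \<le> card C"
  unfolding girth_def by (rule Least_le) blast

lemma girth_cycle:
  assumes "is_cycle E C"
  obtains C' where "is_cycle E C'" "card C' = girth E"
  using LeastI_ex[of "\<lambda>n. \<exists>C. is_cycle E C \<and> card C = n"] assms
  unfolding girth_def by blast

subsection \<open>Connected graphs\<close>

lemma connected_graph_boundary_edge:
  assumes "connected_graph V E" "W \<subseteq> V" "W \<noteq> {}" "W \<noteq> V"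
  obtains x y where "x \<in> W" "y \<notin> W" "{x, y} \<in> E"
proof -
  obtain u v where u: "u \<in> W" and v: "v \<in> V" "v \<notin> W" using assms by auto
  then have "(u, v) \<in> {(x, y). {x, y} \<in> E}\<^sup>*"
    using assms by (auto simp: connected_graph_def)
  \<comment> \<open>Induction along the walk: once the vertex reached lies outside \<open>W\<close>,
    a crossing edge has been met.\<close>
  then have "v \<notin> W \<longrightarrow> (\<exists>x y. x \<in> W \<and> y \<notin> W \<and> {x, y} \<in> E)"
    by (induction rule: rtrancl_induct) (use u in auto)
  then show ?thesis using v that by blast
qed

text \<open>Take a maximal nonempty vertex set \<open>W\<close> inducing at least
  \<open>card W - 1\<close> edges. If \<open>W\<close> were not \<open>V\<close>, adding the outer
  end of a boundary edge would gain one vertex and at least one edge. The bound keeps the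
  subtraction in \<open>cycle_rank\<close> exact.\<close>

lemma connected_graph_card_le:
  assumes "finite V" "\<And>e. e \<in> E \<Longrightarrow> e \<subseteq> V" "connected_graph V E"
  shows "card V \<le> card E + 1"
proof -
  have finE: "finite E" using assms(1,2) finite_subset[of E "Pow V"] by auto
  define \<W> where "\<W> = {W. W \<subseteq> V \<and> W \<noteq> {} \<and> card W \<le> card {e \<in> E. e \<subseteq> W} + 1}"
  have "finite \<W>" using assms(1) by (simp add: \<W>_def)
  moreover obtain a where "a \<in> V" using assms(3) by (auto simp: connected_graph_def)
  then have "{a} \<in> \<W>" by (simp add: \<W>_def)
  ultimately obtain W where W: "W \<in> \<W>" and max: "\<And>U. U \<in> \<W> \<Longrightarrow> W \<subseteq> U \<Longrightarrow> W = U"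
    using finite_has_maximal[of \<W>] by blast
  note W = W[unfolded \<W>_def]
  have "W = V"
  proof (rule ccontr)
    assume "W \<noteq> V"
    then obtain x y where xy: "x \<in> W" "y \<notin> W" "{x, y} \<in> E"
      using connected_graph_boundary_edge[OF assms(3)] W by blast
    have "insert {x, y} {e \<in> E. e \<subseteq> W} \<subseteq> {e \<in> E. e \<subseteq> insert y W}"
      using xy by auto
    then have "card (insert {x, y} {e \<in> E. e \<subseteq> W}) \<le> card {e \<in> E. e \<subseteq> insert y W}"
      using finE by (intro card_mono) auto
    moreover have "card (insert {x, y} {e \<in> E. e \<subseteq> W}) = Suc (card {e \<in> E. e \<subseteq> W})"
      using finE xy by (subst card_insert_disjoint) auto
    moreover have "card (insert y W) = Suc (card W)"
      using finite_subset[of W V] W xy assms(1) by simp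
    moreover have "y \<in> V" using xy assms(2) by blast
    ultimately have "insert y W \<in> \<W>" using W by (auto simp: \<W>_def)
    then show False using max[of "insert y W"] xy by blast
  qed
  moreover have "{e \<in> E. e \<subseteq> V} = E" using assms(2) by auto
  ultimately show ?thesis using W by simp
qed

subsection \<open>Faces of the broken-circuit complex\<close>

lemma linear_order_on_has_max:
  assumes "linear_order_on E R" "finite C" "C \<noteq> {}" "C \<subseteq> E"
  shows "\<exists>m\<in>C. \<forall>e\<in>C. (e, m) \<in> R"
  using assms(2,3,4)
proof (induction rule: finite_ne_induct)
  case (singleton x)
  then show ?case using assms(1) by (auto simp: order_on_defs refl_on_def)
next
  case (insert x F)
  then obtain m where m: "m \<in> F" "\<forall>e\<in>F. (e, m) \<in> R" by auto
  have R: "refl_on E R" "trans R" "total_on E R" using assms(1) by (auto simp: order_on_defs)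
  have "(x, m) \<in> R \<or> (m, x) \<in> R"
    using R(1,3) insert.prems m(1) by (cases "x = m") (auto simp: total_on_def refl_on_def)
  then show ?case
    using m insert.prems R(1,2) by (auto simp: refl_on_def dest: transD)
qed

lemma linear_order_on_max_unique:
  assumes "linear_order_on E R" "m \<in> C" "m' \<in> C"
    "\<forall>e\<in>C. (e, m) \<in> R" "\<forall>e\<in>C. (e, m') \<in> R"
  shows "m = m'"
  using assms by (meson antisymD linear_order_on_def partial_order_onD(3))

lemma broken_circuit_card:
  assumes "broken_circuit E R B"
  shows "girth E - 1 \<le> card B"
proof -
  obtain C m where C: "is_cycle E C" "m \<in> C" "B = C - {m}"
    using assms by (auto simp: broken_circuit_def)
  then show ?thesis using girth_le[OF C(1)] by simp
qed

text \<open>Deleting the largest edge is a bijection from the cycles of length \<open>n\<close> to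
  the broken circuits with \<open>n - 1\<close> edges; injectivity is the parity argument behind
  \<open>is_cycle_Diff_inject\<close>.\<close>

lemma card_broken_circuits:
  assumes "linear_order_on E R" "n \<noteq> 0"
  shows "card {B. broken_circuit E R B \<and> card B = n - 1} = num_cycles E n"
proof -
  let ?\<C> = "{C. is_cycle E C \<and> card C = n}"
  \<comment> \<open>On a cycle this picks the unique largest edge; on other sets the value may be
    arbitrary.\<close>
  define m where "m C = (SOME m. m \<in> C \<and> (\<forall>e\<in>C. (e, m) \<in> R))" for C
  have m: "m C \<in> C \<and> (\<forall>e\<in>C. (e, m C) \<in> R)" if "is_cycle E C" for C
  proof -
    have "C \<noteq> {}" using is_cycle_card_ge_3[OF that] by auto
    then have "\<exists>m. m \<in> C \<and> (\<forall>e\<in>C. (e, m) \<in> R)"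
      using linear_order_on_has_max[OF assms(1)] is_cycle_finite[OF that] is_cycle_subset[OF that]
      by blast
    then show ?thesis unfolding m_def by (rule someI_ex)
  qed
  have "{B. broken_circuit E R B \<and> card B = n - 1} = (\<lambda>C. C - {m C}) ` ?\<C>"
  proof (intro equalityI subsetI)
    fix B assume "B \<in> {B. broken_circuit E R B \<and> card B = n - 1}"
    then obtain C k where C: "is_cycle E C" "k \<in> C" "\<forall>e\<in>C. (e, k) \<in> R" "B = C - {k}"
      "card B = n - 1" by (auto simp: broken_circuit_def)
    have "k = m C" using linear_order_on_max_unique[OF assms(1)] C m by blast
    \<comment> \<open>Both \<open>card C\<close> and \<open>n\<close> are positive, so they agree
      once their predecessors do.\<close>
    moreover have "card C = n"
      using C is_cycle_card_ge_3[OF C(1)] assms(2) by auto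
    ultimately show "B \<in> (\<lambda>C. C - {m C}) ` ?\<C>" using C by blast
  next
    fix B assume "B \<in> (\<lambda>C. C - {m C}) ` ?\<C>"
    then obtain C where C: "is_cycle E C" "card C = n" "B = C - {m C}" by blast
    then have "card B = n - 1" using m[OF C(1)] by simp
    then show "B \<in> {B. broken_circuit E R B \<and> card B = n - 1}"
      using m[OF C(1)] C by (auto simp: broken_circuit_def)
  qed
  moreover have "inj_on (\<lambda>C. C - {m C}) ?\<C>"
    by (rule inj_onI) (metis (no_types, lifting) m is_cycle_Diff_inject mem_Collect_eq)
  ultimately show ?thesis by (simp add: card_image num_cycles_def)
qed

lemma num_faces_BC_below_girth:
  assumes "finite E" "i + 1 < girth E"
  shows "num_faces (BC E R) i = card E choose i"
proof -
  have "i < card S" if "B \<subseteq> S" "S \<subseteq> E" "broken_circuit E R B" for B S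
  proof -
    have "card B \<le> card S" using that(1,2) assms(1) by (meson card_mono finite_subset)
    then show ?thesis using broken_circuit_card[OF that(3)] assms(2) by linarith
  qed
  then have "{S \<in> BC E R. card S = i} = {S. S \<subseteq> E \<and> card S = i}"
    by (auto simp: BC_def)
  then show ?thesis using assms(1) by (simp add: num_faces_def n_subsets)
qed

text \<open>A set of \<open>girth E - 1\<close> edges containing a broken circuit is no larger than
  it, hence equal to it. So the non-faces of this size are the broken circuits of this size, one for
  each shortest cycle.\<close>

lemma num_faces_BC_girth:
  assumes "finite E" "linear_order_on E R" "girth E \<noteq> 0"
  shows "int (num_faces (BC E R) (girth E - 1)) =
    int (card E choose (girth E - 1)) - int (num_cycles E (girth E))"
proof -
  let ?k = "girth E - 1"
  let ?A = "{S. S \<subseteq> E \<and> card S = ?k}"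
  let ?B = "{B. broken_circuit E R B \<and> card B = ?k}"
  have BE: "B \<subseteq> E" if "broken_circuit E R B" for B
    using that is_cycle_subset by (fastforce simp: broken_circuit_def)
  have "B = S" if "B \<subseteq> S" "S \<subseteq> E" "card S = ?k" "broken_circuit E R B" for B S
    using that broken_circuit_card[OF that(4)] assms(1) by (metis card_seteq finite_subset)
  then have "{S \<in> BC E R. card S = ?k} = ?A - ?B"
    by (auto simp: BC_def)
  moreover have "?B \<subseteq> ?A" using BE by auto
  moreover have "finite ?A" using assms(1) by simp
  ultimately have "int (card {S \<in> BC E R. card S = ?k}) = int (card ?A) - int (card ?B)"
    by (simp add: card_Diff_subset card_mono finite_subset of_nat_diff)
  then show ?thesis
    using assms by (simp only: num_faces_def n_subsets card_broken_circuits[OF assms(2,3)])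
qed

subsection \<open>The h-polynomial\<close>

lemma coeff_one_minus_X_power:
  "coeff ([:1, -1:] ^ n :: int poly) k = (-1) ^ k * int (n choose k)"
proof (induction n arbitrary: k)
  case 0
  then show ?case by (cases k) auto
next
  case (Suc n)
  then show ?case by (cases k) (auto simp: coeff_pCons algebra_simps)
qed

text \<open>A summand with \<open>i > j\<close> is divisible by the \<open>i\<close>-th power of z
  and contributes nothing; for \<open>i \<le> j\<close> the coefficient of index
  \<open>j - i\<close> of the power of 1 - z remains.\<close>

lemma coeff_h_poly:
  assumes "j \<le> card V - 1"
  shows "coeff (h_poly V E R) j =
    (\<Sum>i=0..j. int (num_faces (BC E R) i) * ((-1) ^ (j - i) * int ((card V - 1 - i) choose (j - i))))"
proof -
  let ?r = "card V - 1"
  let ?t = "\<lambda>i. int (num_faces (BC E R) i) * ((-1) ^ (j - i) * int ((?r - i) choose (j - i)))"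
  have "coeff (of_nat (num_faces (BC E R) i) * [:0, 1:] ^ i * [:1, -1:] ^ (?r - i)) j =
      (if j < i then 0 else ?t i)" for i
  proof -
    have "of_nat (num_faces (BC E R) i) * [:0, 1:] ^ i = monom (int (num_faces (BC E R) i)) i"
      by (simp add: monom_altdef of_nat_poly)
    then show ?thesis by (simp add: coeff_monom_mult coeff_one_minus_X_power)
  qed
  then have "coeff (h_poly V E R) j = (\<Sum>i=0..?r. if j < i then 0 else ?t i)"
    by (simp add: h_poly_def Let_def coeff_sum)
  also have "\<dots> = (\<Sum>i=0..j. ?t i)"
    using assms by (intro sum.mono_neutral_cong_right) auto
  finally show ?thesis .
qed

text \<open>Negating the upper index absorbs the sign and leaves the upper index
  \<open>j - r - 1\<close>, free of \<open>i\<close>. The sum becomes a Vandermonde convolution,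
  computed over the reals to allow negative upper indices.\<close>

lemma alternating_Vandermonde:
  assumes "j \<le> r" "r \<le> m"
  shows "(\<Sum>i=0..j. int (m choose i) * ((-1) ^ (j - i) * int ((r - i) choose (j - i)))) =
    int ((m - r + j - 1) choose j)"
proof -
  have upper: "(-1) ^ (j - i) * real ((r - i) choose (j - i)) = (real j - real r - 1) gchoose (j - i)"
    if "i \<le> j" for i
  proof -
    have "real (j - i) - real (r - i) - 1 = real j - real r - 1"
      using that assms(1) by (simp add: of_nat_diff)
    then have "real ((r - i) choose (j - i)) =
        (-1) ^ (j - i) * ((real j - real r - 1) gchoose (j - i))"
      using gbinomial_negated_upper[of "real (r - i)" "j - i"] by (simp only: binomial_gbinomial)
    \<comment> \<open>The two equal signs multiply to 1.\<close>
    then show ?thesis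
      by (simp flip: mult.assoc power_add)
  qed
  have "(\<Sum>i=0..j. real (m choose i) * ((-1) ^ (j - i) * real ((r - i) choose (j - i)))) =
      (\<Sum>i=0..j. (real m gchoose i) * ((real j - real r - 1) gchoose (j - i)))"
    by (intro sum.cong) (simp_all only: atLeastAtMost_iff upper binomial_gbinomial[of m])
  also have "\<dots> = (real m + (real j - real r - 1)) gchoose j"
    by (rule gbinomial_Vandermonde)
  also have "\<dots> = real ((m - r + j - 1) choose j)"
  \<comment> \<open>For \<open>j = 0\<close> and \<open>m = r\<close> the natural subtraction
    truncates, but both binomials are then 1.\<close>
  proof (cases "j = 0")
    case False
    then have "real m + (real j - real r - 1) = real (m - r + j - 1)"
      using assms(2) by (simp add: of_nat_diff)
    then show ?thesis by (simp add: binomial_gbinomial)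
  qed simp
  finally have "real_of_int (\<Sum>i=0..j. int (m choose i) * ((-1) ^ (j - i) * int ((r - i) choose (j - i)))) =
    real_of_int (int ((m - r + j - 1) choose j))"
    by simp
  then show ?thesis by (simp only: of_int_eq_iff)
qed

text \<open>Serves both claims of the theorem: up to index \<open>j\<close> the face numbers differ
  from the full binomials at most at \<open>j\<close> itself, and that defect enters the coefficient
  with factor 1.\<close>

lemma coeff_h_poly_first_defect:
  assumes "card V \<noteq> 0" "card V \<le> card E + 1" "j \<le> card V - 1"
    and "\<And>i. i < j \<Longrightarrow> num_faces (BC E R) i = card E choose i"
  shows "coeff (h_poly V E R) j = int ((cycle_rank V E + j - 1) choose j)
    + (int (num_faces (BC E R) j) - int (card E choose j))"
proof -
  let ?c = "\<lambda>i. (-1) ^ (j - i) * int ((card V - 1 - i) choose (j - i))"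
  have "coeff (h_poly V E R) j = (\<Sum>i=0..j. int (num_faces (BC E R) i) * ?c i)"
    by (rule coeff_h_poly[OF assms(3)])
  also have "\<dots> = (\<Sum>i=0..<j. int (card E choose i) * ?c i) + int (num_faces (BC E R) j)"
    using assms(4) by (simp add: sum.last_plus)
  also have "\<dots> = (\<Sum>i=0..j. int (card E choose i) * ?c i)
      + (int (num_faces (BC E R) j) - int (card E choose j))"
    by (simp add: sum.last_plus)
  also have "(\<Sum>i=0..j. int (card E choose i) * ?c i) =
      int ((card E - (card V - 1) + j - 1) choose j)"
    using assms(2,3) by (intro alternating_Vandermonde) auto
  \<comment> \<open>Nonemptiness of \<open>V\<close> makes \<open>card V - 1\<close> a true
    predecessor.\<close>
  also have "card E - (card V - 1) = cycle_rank V E"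
    using assms(1,2) by (simp add: cycle_rank_def)
  finally show ?thesis .
qed

theorem theorem8p1:
  fixes V :: "'a set" and E :: "'a set set" and R :: "'a set rel"
  assumes "finite_simple_graph V E"
    and "connected_graph V E"
    and "\<exists>C. is_cycle E C"
    and "linear_order_on E R"
  shows "(\<forall>j. j \<le> girth E - 2 \<longrightarrow>
            coeff (h_poly V E R) j = int ((cycle_rank V E + j - 1) choose j)) \<and>
         coeff (h_poly V E R) (girth E - 1) =
           int ((cycle_rank V E + girth E - 2) choose (girth E - 1)) - int (num_cycles E (girth E))"
proof -
  have V: "finite V" "\<And>e. e \<in> E \<Longrightarrow> e \<subseteq> V"
    using assms(1) by (auto simp: finite_simple_graph_def)
  have finE: "finite E" using V finite_subset[of E "Pow V"] by auto
  obtain C where C: "is_cycle E C" "card C = girth E"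
    using assms(3) girth_cycle by blast
  have g: "3 \<le> girth E" "girth E \<le> card V"
    using is_cycle_card_ge_3[OF C(1)] is_cycle_card_le[OF V C(1)] C(2) by auto
  note faces = num_faces_BC_below_girth[OF finE]
  note h = coeff_h_poly_first_defect[OF _ connected_graph_card_le[OF V assms(2)]]
  show ?thesis
  proof (intro conjI allI impI)
    fix j assume "j \<le> girth E - 2"
    \<comment> \<open>As the girth is at least 3, \<open>girth E - 2\<close> is not truncated and
      \<open>j + 1 < girth E\<close>, so the defect at \<open>j\<close> is zero.\<close>
    then show "coeff (h_poly V E R) j = int ((cycle_rank V E + j - 1) choose j)"
      using g h[of j R] faces by simp
  next
    have "cycle_rank V E + (girth E - 1) - 1 = cycle_rank V E + girth E - 2"
      using g by simp
    \<comment> \<open>Here the defect is minus the number of shortest cycles.\<close>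
    then show "coeff (h_poly V E R) (girth E - 1) =
        int ((cycle_rank V E + girth E - 2) choose (girth E - 1)) - int (num_cycles E (girth E))"
      using g h[of "girth E - 1" R] faces num_faces_BC_girth[OF finE assms(4)] by simp
  qed
qed

end
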